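(* Let $T(n,k)$ be the integers defined for $0\le k\le n$ by $T(n,0)=T(n,n)=1$ and $T(n,k) = 2T(n-1,k-1)+T(n-1,k)$ for $0<k<n$, with $T(n,k)=0$ if $k<0$ or $k>n$. (i) For each $k\ge 0$, the generating function $\sum_{n=0}^\infty T(n,n-k)x^n$ is given by $$\frac{x^k}{(1-2x)^k(1-x)}.$$ (ii) For $0\le k\le n$, $$T(n,k)=\sum_{i=n-k}^n (-1)^{n-k-i}\,2^{n-i}\binom{n}{i}.$$ (iii) For $0\le k\le n$, $$T(n,k)=\sum_{i=n-k}^n \binom{n}{i}\binom{i-1}{n-k-1},$$ where we interpret $\binom{-1}{-1}$ to mean $1$.
   Context: The generating function identity is one of formal power series over $\mathbb{Z}$. In (iii), the usual convention $\binom{m}{-1}=0$ for $m\ge0$ is in force, the only exceptional convention being $\binom{-1}{-1}=1$. *)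

theory Defs
  imports Complex_Main "HOL-Computational_Algebra.Formal_Power_Series"
begin

text \<open>
  The column index is an integer, so that \<open>T n (int n - int k)\<close> is the zero entry with
  negative column (and not \<open>T n 0\<close>) when \<open>n < k\<close>.
\<close>

function T :: "nat \<Rightarrow> int \<Rightarrow> int" where
  "T n k =
     (if k < 0 \<or> k > int n then 0
      else if k = 0 \<or> k = int n then 1
      else 2 * T (n - 1) (k - 1) + T (n - 1) k)"
  by pat_completeness auto
termination
  by (relation "measure fst") auto

declare T.simps [simp del]

lemma T_outside: "k < 0 \<or> k > int n \<Longrightarrow> T n k = 0"
  by (subst T.simps) simp

lemma T_0 [simp]: "T n 0 = 1"
  by (subst T.simps) simp

lemma T_self [simp]: "T n (int n) = 1"
  by (subst T.simps) simp

lemma T_rec: "0 < k \<Longrightarrow> k < int n \<Longrightarrow> T n k = 2 * T (n - 1) (k - 1) + T (n - 1) k"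
  by (subst T.simps) simp

text \<open>
  The library's division on formal power series needs coefficients of class \<^class>\<open>inverse\<close>,
  which \<^typ>\<open>int\<close> is not. For a denominator with constant coefficient \<open>1\<close>, the quotient in the
  ring of integer power series is obtained from the ring-generic inverse series; the two lemmas
  below confirm that it is the unique quotient.
\<close>

definition int_fps_quot :: "int fps \<Rightarrow> int fps \<Rightarrow> int fps" where
  "int_fps_quot f g = f * fps_right_inverse g 1"

lemma int_fps_quot_mult:
  assumes "fps_nth g 0 = 1"
  shows "int_fps_quot f g * g = f"
proof -
  have "g * fps_right_inverse g 1 = 1"
    by (rule fps_right_inverse) (simp add: assms)
  then show ?thesis
    by (simp add: int_fps_quot_def mult.assoc mult.commute [of _ g])
qed

lemma int_fps_quot_unique:
  assumes "fps_nth g 0 = 1" and "h * g = f"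
  shows "h = int_fps_quot f g"
proof -
  have "g \<noteq> 0"
    using assms(1) by auto
  moreover have "h * g = int_fps_quot f g * g"
    using assms by (simp add: int_fps_quot_mult)
  ultimately show ?thesis
    by simp
qed

text \<open>
  Binomial coefficients with integer arguments: the generalised binomial coefficient for lower
  index \<open>j \<ge> 0\<close>, and \<open>0\<close> for \<open>j < 0\<close>, with the one exception that the upper and lower indices
  are both \<open>-1\<close>. The values are rational because \<^const>\<open>gbinomial\<close> is set up for
  fields.
\<close>

definition binom :: "int \<Rightarrow> int \<Rightarrow> rat" where
  "binom m j =
     (if m = -1 \<and> j = -1 then 1
      else if j < 0 then 0
      else of_int m gchoose nat j)"

end

theory Submission
  imports Defs
begin

text \<open>
  Indexing the triangle by the distance \<open>m = n - k\<close> from its right edge turns the defining rule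
  into \<open>a (n + 1) (m + 1) = 2 * a n (m + 1) + a n m\<close> for \<open>a n m = T n (n - m)\<close>. In this form it
  also holds at and beyond the left edge, so together with \<open>a n 0 = 1\<close> and \<open>a 0 (m + 1) = 0\<close> it
  determines the triangle without any side condition (\<open>T_diagonal_unique\<close>).

  Summed over \<open>n\<close>, the rule says that the generating functions \<open>F m\<close> of the diagonals satisfy
  \<open>F (m + 1) * (1 - 2 * X) = X * F m\<close>; as \<open>F 0 = 1 / (1 - X)\<close>, the first formula follows. Each of
  the two sums satisfies the same rule, by Pascal's rule for \<open>n choose i\<close>: the part with
  \<open>n choose (i - 1)\<close> has its index shifted by one. In the first sum the two parts are directly
  the two terms of the rule. In the second they are \<open>a n (m + 1)\<close> and the sum of
  \<open>(n choose j) * (j choose m)\<close>, and Pascal's rule for \<open>j choose m\<close> supplies the remaining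
  \<open>a n (m + 1) + a n m\<close>; the convention for \<open>binom (-1) (-1)\<close> makes this work at \<open>j = m = 0\<close>.
\<close>

lemma T_diagonal_rec:
  "T (Suc n) (int n - int m) = 2 * T n (int n - int (Suc m)) + T n (int n - int m)"
proof (cases m n rule: linorder_cases)
  case less
  then show ?thesis
    using T_rec[of "int n - int m" "Suc n"] by (simp add: algebra_simps)
next
  case equal
  then show ?thesis by (simp add: T_outside)
next
  case greater
  then show ?thesis by (simp add: T_outside)
qed

text \<open>
  The hypotheses hold for all \<open>n\<close> and \<open>m\<close>, including \<open>m > n\<close>, which is what lets the induction
  run on \<open>n\<close> alone.
\<close>

lemma T_diagonal_unique:
  fixes f :: "nat \<Rightarrow> nat \<Rightarrow> 'a :: ring_1"
  assumes zero_right: "\<And>n. f n 0 = 1"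
    and zero_left: "\<And>m. f 0 (Suc m) = 0"
    and rec: "\<And>n m. f (Suc n) (Suc m) = 2 * f n (Suc m) + f n m"
  shows "of_int (T n (int n - int m)) = f n m"
proof (induction n arbitrary: m)
  case 0
  show ?case
    by (cases m) (simp_all add: T_outside assms)
next
  case (Suc n)
  show ?case
  proof (cases m)
    case 0
    then show ?thesis using T_self[of "Suc n"] by (simp add: zero_right del: T_self)
  next
    case (Suc m')
    have "T (Suc n) (int (Suc n) - int m) = T (Suc n) (int n - int m')"
      by (simp add: Suc)
    also have "\<dots> = 2 * T n (int n - int (Suc m')) + T n (int n - int m')"
      by (rule T_diagonal_rec)
    finally show ?thesis
      using Suc.IH[of m'] Suc.IH[of "Suc m'"] by (simp add: Suc rec)
  qed
qed

definition diagonal_fps :: "nat \<Rightarrow> int fps" where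
  "diagonal_fps k = Abs_fps (\<lambda>n. T n (int n - int k))"

lemma diagonal_fps_0: "diagonal_fps 0 * (1 - fps_X) = 1"
  by (rule fps_ext)
    (auto simp: diagonal_fps_def right_diff_distrib fps_mult_fps_X_commute[symmetric])

lemma diagonal_fps_Suc: "diagonal_fps (Suc k) * (1 - 2 * fps_X) = fps_X * diagonal_fps k"
proof (rule fps_ext)
  fix n
  have eq: "diagonal_fps (Suc k) * (1 - 2 * fps_X) =
      diagonal_fps (Suc k) - fps_X * (fps_const 2 * diagonal_fps (Suc k))"
    by (simp add: algebra_simps flip: numeral_fps_const)
  show "fps_nth (diagonal_fps (Suc k) * (1 - 2 * fps_X)) n = fps_nth (fps_X * diagonal_fps k) n"
  proof (cases n)
    case 0
    then show ?thesis
      unfolding eq by (simp add: diagonal_fps_def T_outside)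
  next
    case (Suc n')
    then show ?thesis
      unfolding eq using T_diagonal_rec[of n' k] by (simp add: diagonal_fps_def)
  qed
qed

lemma diagonal_fps_mult_denominator:
  "diagonal_fps k * ((1 - 2 * fps_X) ^ k * (1 - fps_X)) = fps_X ^ k"
proof (induction k)
  case 0
  show ?case by (simp add: diagonal_fps_0)
next
  case (Suc k)
  have "diagonal_fps (Suc k) * ((1 - 2 * fps_X) ^ Suc k * (1 - fps_X)) =
      (diagonal_fps (Suc k) * (1 - 2 * fps_X)) * ((1 - 2 * fps_X) ^ k * (1 - fps_X))"
    by (simp only: power_Suc mult_ac)
  also have "\<dots> = fps_X * (diagonal_fps k * ((1 - 2 * fps_X) ^ k * (1 - fps_X)))"
    by (simp only: diagonal_fps_Suc mult.assoc)
  finally show ?case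
    by (simp add: Suc.IH)
qed

lemma diagonal_fps_eq_quot:
  "diagonal_fps k = int_fps_quot (fps_X ^ k) ((1 - 2 * fps_X) ^ k * (1 - fps_X))"
  by (rule int_fps_quot_unique)
    (simp_all add: diagonal_fps_mult_denominator fps_mult_nth_0 fps_nth_power_0)

definition alternating_sum :: "nat \<Rightarrow> nat \<Rightarrow> rat" where
  "alternating_sum n m = (\<Sum>i = m..n. (-1) ^ (i - m) * 2 ^ (n - i) * of_nat (n choose i))"

lemma alternating_sum_0: "alternating_sum n 0 = 1"
  using binomial_ring[of "-1 :: rat" 2 n]
  by (simp add: alternating_sum_def atMost_atLeast0 mult_ac)

lemma sum_choose_shift_index:
  fixes c :: "nat \<Rightarrow> 'a :: semiring_1"
  shows "(\<Sum>j = m..n. c (Suc j) * of_nat (n choose Suc j)) =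
    (\<Sum>i = Suc m..n. c i * of_nat (n choose i))"
proof -
  have "(\<Sum>j = m..n. c (Suc j) * of_nat (n choose Suc j)) =
      (\<Sum>i = Suc m..Suc n. c i * of_nat (n choose i))"
    by (rule sum.shift_bounds_cl_Suc_ivl[symmetric])
  also have "\<dots> = (\<Sum>i = Suc m..n. c i * of_nat (n choose i))"
    by (cases "m \<le> n") (simp_all add: binomial_eq_0)
  finally show ?thesis .
qed

text \<open>
  The weights are arbitrary, so that one use of Pascal's rule serves both sums.
\<close>

lemma sum_choose_Suc:
  fixes c :: "nat \<Rightarrow> 'a :: semiring_1"
  shows "(\<Sum>i = Suc m..Suc n. c i * of_nat (Suc n choose i)) =
    (\<Sum>i = Suc m..n. c i * of_nat (n choose i)) + (\<Sum>j = m..n. c (Suc j) * of_nat (n choose j))"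
  unfolding sum.shift_bounds_cl_Suc_ivl
  unfolding sum_choose_shift_index[symmetric]
  by (simp add: algebra_simps sum.distrib)

lemma alternating_sum_Suc:
  "alternating_sum (Suc n) (Suc m) = 2 * alternating_sum n (Suc m) + alternating_sum n m"
proof -
  have "(\<Sum>i = Suc m..n. (-1 :: rat) ^ (i - Suc m) * 2 ^ (Suc n - i) * of_nat (n choose i)) =
      2 * alternating_sum n (Suc m)"
    unfolding alternating_sum_def sum_distrib_left
    by (rule sum.cong) (simp_all add: Suc_diff_le)
  then show ?thesis
    unfolding alternating_sum_def sum_choose_Suc by simp
qed

definition binom_sum :: "nat \<Rightarrow> nat \<Rightarrow> rat" where
  "binom_sum n m = (\<Sum>i = m..n. binom (int i - 1) (int m - 1) * of_nat (n choose i))"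

lemma binom_minus_1: "binom (int i - 1) (-1) = (if i = 0 then 1 else 0)"
  by (simp add: binom_def)

lemma binom_of_nat: "binom (int i) (int m) = of_nat (i choose m)"
  by (simp add: binom_def binomial_gbinomial)

lemma binom_sum_0: "binom_sum n 0 = 1"
proof -
  have "binom_sum n 0 = (\<Sum>i = 0..n. if i = 0 then 1 else 0)"
    unfolding binom_sum_def by (rule sum.cong) (simp_all add: binom_minus_1)
  then show ?thesis by simp
qed

text \<open>
  At \<open>j = m\<close> the summand \<open>binom (j - 1) m\<close> of Pascal's rule has to be left out: it vanishes for
  \<open>m > 0\<close>, but \<open>binom (-1) 0 = 1\<close>. The sum for \<open>m + 1\<close> starts at \<open>m + 1\<close>, so it omits this term.
\<close>

lemma choose_eq_binom_pred:
  assumes "m \<le> j"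
  shows "of_nat (j choose m) =
    binom (int j - 1) (int m - 1) + (if j = m then 0 else binom (int j - 1) (int m))"
proof (cases j)
  case 0
  then show ?thesis using assms by (simp add: binom_def)
next
  case (Suc j')
  show ?thesis
  proof (cases m)
    case 0
    then show ?thesis using Suc by (simp add: binom_minus_1 binom_of_nat[of _ 0, simplified] binom_def)
  next
    case (Suc m')
    then show ?thesis using \<open>j = Suc j'\<close>
      using binom_of_nat[of j' "Suc m'"] by (auto simp: binom_of_nat)
  qed
qed

lemma binom_sum_Suc:
  "binom_sum (Suc n) (Suc m) = 2 * binom_sum n (Suc m) + binom_sum n m"
proof -
  have "(\<Sum>j = m..n. of_nat (j choose m) * of_nat (n choose j)) =
      (\<Sum>j = m..n. binom (int j - 1) (int m - 1) * of_nat (n choose j)) +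
      (\<Sum>j = m..n. (if j = m then 0 else binom (int j - 1) (int m)) * of_nat (n choose j))"
    unfolding sum.distrib[symmetric] distrib_right[symmetric]
    by (rule sum.cong) (simp_all add: choose_eq_binom_pred)
  also have "(\<Sum>j = m..n. (if j = m then 0 else binom (int j - 1) (int m)) * of_nat (n choose j)) =
      (\<Sum>j = Suc m..n. binom (int j - 1) (int m) * of_nat (n choose j))"
    by (rule sum.mono_neutral_cong_right) auto
  finally have "(\<Sum>j = m..n. of_nat (j choose m) * of_nat (n choose j)) =
      binom_sum n m + binom_sum n (Suc m)"
    by (simp add: binom_sum_def)
  then show ?thesis
    using sum_choose_Suc[of "\<lambda>i. binom (int i - 1) (int m)" n m]
    by (simp add: binom_sum_def binom_of_nat del: sum.cl_ivl_Suc)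
qed

lemma T_eq_alternating_sum: "of_int (T n (int n - int m)) = alternating_sum n m"
  by (rule T_diagonal_unique)
    (simp_all only: alternating_sum_0 alternating_sum_Suc, simp add: alternating_sum_def)

lemma T_eq_binom_sum: "of_int (T n (int n - int m)) = binom_sum n m"
  by (rule T_diagonal_unique)
    (simp_all only: binom_sum_0 binom_sum_Suc, simp add: binom_sum_def)

theorem theorem4p1p5:
  shows
    "(\<forall>k :: nat.
        Abs_fps (\<lambda>n. T n (int n - int k)) =
          int_fps_quot (fps_X ^ k) ((1 - 2 * fps_X) ^ k * (1 - fps_X))) \<and>
     (\<forall>(n :: nat) (k :: nat). k \<le> n \<longrightarrow>
        of_int (T n (int k)) =
          (\<Sum>i = n - k..n.
             (-1 :: rat) powi (int n - int k - int i) * 2 ^ (n - i) * of_nat (n choose i))) \<and>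
     (\<forall>(n :: nat) (k :: nat). k \<le> n \<longrightarrow>
        of_int (T n (int k)) =
          (\<Sum>i = n - k..n. of_nat (n choose i) * binom (int i - 1) (int n - int k - 1)))"
proof (intro conjI allI impI)
  fix k
  show "Abs_fps (\<lambda>n. T n (int n - int k)) =
      int_fps_quot (fps_X ^ k) ((1 - 2 * fps_X) ^ k * (1 - fps_X))"
    using diagonal_fps_eq_quot by (simp add: diagonal_fps_def)
next
  fix n k :: nat
  assume "k \<le> n"
  then have T_eq: "T n (int k) = T n (int n - int (n - k))"
    by simp
  show "of_int (T n (int k)) =
      (\<Sum>i = n - k..n. (-1 :: rat) powi (int n - int k - int i) * 2 ^ (n - i) * of_nat (n choose i))"
    unfolding T_eq T_eq_alternating_sum alternating_sum_def
  proof (rule sum.cong)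
    fix i
    assume "i \<in> {n - k..n}"
    \<comment> \<open>The exponent \<open>n - k - i\<close> is nonpositive, and \<open>- 1\<close> is its own inverse.\<close>
    with \<open>k \<le> n\<close> have "int n - int k - int i = - int (i - (n - k))"
      by auto
    then have "(-1 :: rat) powi (int n - int k - int i) = (-1) ^ (i - (n - k))"
      by (simp only: power_int_minus power_int_of_nat) (simp flip: power_inverse)
    then show "(-1) ^ (i - (n - k)) * 2 ^ (n - i) * of_nat (n choose i) =
        (-1 :: rat) powi (int n - int k - int i) * 2 ^ (n - i) * of_nat (n choose i)"
      by simp
  qed simp
  show "of_int (T n (int k)) =
      (\<Sum>i = n - k..n. of_nat (n choose i) * binom (int i - 1) (int n - int k - 1))"
    unfolding T_eq T_eq_binom_sum binom_sum_def using \<open>k \<le> n\<close>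
    by (simp add: mult.commute of_nat_diff)
qed

end
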